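(* Let $P(\lambda)=\sum_{j=0}^m A_j\lambda^j$ be an $n\times n$ matrix polynomial with $A_j\in\mathbb{C}^{n\times n}$ and $A_m$ nonsingular, let $w=\{w_0,w_1,\dots,w_m\}$ be nonnegative weights with $w_0>0$, and let $\Sigma=\{\mu_1,\mu_2,\dots,\mu_k\}$ be a given set of $k\le n$ distinct complex numbers. Suppose that the quantities $\beta_1,\beta_2,\dots,\beta_k$ (defined in the context) are nonzero. Then for every $\gamma>0$ such that $\operatorname{rank}(V(\gamma))=k$, the scalars $\mu_1,\mu_2,\dots,\mu_k$ are eigenvalues of the matrix polynomial $Q_\gamma(\lambda)=P(\lambda)+\Delta_\gamma(\lambda)$, with corresponding eigenvectors $\hat v_1(\gamma),\hat v_2(\gamma),\dots,\hat v_k(\gamma)$, respectively.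
   Context: A scalar $\mu\in\mathbb{C}$ is an eigenvalue of a matrix polynomial $P(\lambda)$ with (right) eigenvector $v\in\mathbb{C}^n$ if $v\ne 0$ and $P(\mu)v=0$. Singular values $s_1\ge s_2\ge\cdots$ are in nonincreasing order. Put $w(\lambda)=\sum_{j=0}^m w_j\lambda^j$ and $\rho=nk-k+1$. Divided differences: $P[\mu_i]=P(\mu_i)$ and $P[\mu_i,\dots,\mu_{i+t}]=\dfrac{P[\mu_i,\dots,\mu_{i+t-1}]-P[\mu_{i+1},\dots,\mu_{i+t}]}{\mu_i-\mu_{i+t}}$ for $t\ge1$. $F_\gamma[P,\Sigma]$ is the $nk\times nk$ block lower triangular matrix whose $(i,j)$th $n\times n$ block is $\gamma^{i-j}P[\mu_j,\mu_{j+1},\dots,\mu_i]$ for $i\ge j$ (so $P(\mu_i)$ on the diagonal) and $0$ for $i<j$. Let $u(\gamma),v(\gamma)\in\mathbb{C}^{nk}$ be a pair of left and right singular vectors of $F_\gamma[P,\Sigma]$ for the singular value $s_\rho(F_\gamma[P,\Sigma])$ (i.e. unit vectors with $F_\gamma[P,\Sigma]v=s_\rho u$ and $F_\gamma[P,\Sigma]^*u=s_\rho v$), partitioned into blocks $u_j(\gamma),v_j(\gamma)\in\mathbb{C}^n$, $j=1,\dots,k$. Let $V(\gamma)=[\,v_1(\gamma)\;\cdots\;v_k(\gamma)\,]\in\mathbb{C}^{n\times k}$. For $i\neq j$ let $\theta_{i,j}=\gamma/(\mu_i-\mu_j)$. Set $\hat v_1(\gamma)=v_1(\gamma)$, $\hat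 u_1(\gamma)=u_1(\gamma)$, and for $p=2,\dots,k$, $$\hat v_p(\gamma)=v_p(\gamma)+\sum_{i=1}^{p-1}(-1)^i\Big(\prod_{j=p-i}^{p-1}\theta_{j,p}\Big)v_{p-i}(\gamma),\qquad \hat u_p(\gamma)=u_p(\gamma)+\sum_{i=1}^{p-1}(-1)^i\Big(\prod_{j=p-i}^{p-1}\theta_{j,p}\Big)u_{p-i}(\gamma).$$ Let $\hat U(\gamma)=[\,\hat u_1(\gamma)\;\cdots\;\hat u_k(\gamma)\,]$ and $\hat V(\gamma)=[\,\hat v_1(\gamma)\;\cdots\;\hat v_k(\gamma)\,]$. For $i,s=1,\dots,k$ let $$\alpha_{i,s}=\frac{1}{w(|\mu_i|)}\sum_{j=0}^m\Big(\frac{\bar\mu_i}{|\mu_i|}\Big)^j\mu_s^j w_j,\qquad \beta_s=\frac1k\sum_{i=1}^k\alpha_{i,s}.$$ Convention: if $\mu_i=0$, then $(\bar\mu_i/|\mu_i|)^j$ is read as $1$ for $j=0$ and $0$ for $j\ge1$ (so that $\alpha_{i,s}=1$). When all $\beta_s\ne0$, define the $n\times n$ matrix $$\Delta_\gamma=-s_\rho(F_\gamma[P,\Sigma])\,\hat U(\gamma)\,\mathrm{diag}\Big\{\frac1{\beta_1},\dots,\frac1{\beta_k}\Big\}\hat V(\gamma)^\dagger,$$ where $\dagger$ denotes the Moore–Penrose pseudoinverse, and $$\Delta_\gamma(\lambda)=\sum_{j=0}^m\Delta_{\gamma,j}\lambda^j,\qquad \Delta_{\gamma,j}=\frac1k\sum_{i=1}^k\Big(\frac{1}{w(|\mu_i|)}\Big(\frac{\bar\mu_i}{|\mu_i|}\Big)^j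 w_j\Big)\Delta_\gamma .$$ *)

theory Defs
  imports
    "Jordan_Normal_Form.Char_Poly"
    "Jordan_Normal_Form.Schur_Decomposition"
    "Jordan_Normal_Form.DL_Rank"
begin

text \<open>
  Conventions. The polynomial \<open>A\<^sub>0 + A\<^sub>1 z + \<dots> + A\<^sub>m z\<^sup>m\<close> is given by \<open>m\<close> and its coefficient
  function. The points \<open>\<mu> 1, \<dots>, \<mu> k\<close> and the blocks of a vector or matrix are numbered from 1,
  whereas entries of vectors and matrices, as in the library, are numbered from 0.
\<close>

definition matpoly_eval :: "nat \<Rightarrow> nat \<Rightarrow> (nat \<Rightarrow> complex mat) \<Rightarrow> complex \<Rightarrow> complex mat" where
  "matpoly_eval n m A z = mat n n (\<lambda>(a, b). \<Sum>j\<le>m. A j $$ (a, b) * z ^ j)"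

definition matpoly_eigenvector ::
  "nat \<Rightarrow> nat \<Rightarrow> (nat \<Rightarrow> complex mat) \<Rightarrow> complex vec \<Rightarrow> complex \<Rightarrow> bool" where
  "matpoly_eigenvector n m A v z \<longleftrightarrow>
     v \<in> carrier_vec n \<and> v \<noteq> 0\<^sub>v n \<and> matpoly_eval n m A z *\<^sub>v v = 0\<^sub>v n"

definition matpoly_eigenvalue :: "nat \<Rightarrow> nat \<Rightarrow> (nat \<Rightarrow> complex mat) \<Rightarrow> complex \<Rightarrow> bool" where
  "matpoly_eigenvalue n m A z \<longleftrightarrow> (\<exists>v. matpoly_eigenvector n m A v z)"

text \<open>\<open>divided_diff P \<mu> i t\<close> is \<open>P[\<mu>\<^sub>i, \<dots>, \<mu>\<^sub>i\<^sub>+\<^sub>t]\<close>.\<close>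

fun divided_diff ::
  "(complex \<Rightarrow> complex mat) \<Rightarrow> (nat \<Rightarrow> complex) \<Rightarrow> nat \<Rightarrow> nat \<Rightarrow> complex mat" where
  "divided_diff P \<mu> i 0 = P (\<mu> i)"
| "divided_diff P \<mu> i (Suc t) =
     (1 / (\<mu> i - \<mu> (i + Suc t))) \<cdot>\<^sub>m (divided_diff P \<mu> i t - divided_diff P \<mu> (Suc i) t)"

definition F_mat ::
  "nat \<Rightarrow> nat \<Rightarrow> (complex \<Rightarrow> complex mat) \<Rightarrow> (nat \<Rightarrow> complex) \<Rightarrow> real \<Rightarrow> complex mat" where
  "F_mat n k P \<mu> \<gamma> = mat (n * k) (n * k) (\<lambda>(a, b).
     let i = a div n + 1; j = b div n + 1 in
     if j \<le> i then (of_real \<gamma> ^ (i - j) \<cdot>\<^sub>m divided_diff P \<mu> j (i - j)) $$ (a mod n, b mod n)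
     else 0)"

text \<open>
  Singular values of a square matrix: square roots of the eigenvalues of \<open>A\<^sup>* A\<close>, listed in
  nonincreasing order and with multiplicity; \<open>singular_value A r\<close> is \<open>s\<^sub>r(A)\<close> for
  \<open>1 \<le> r \<le> dim_row A\<close>. The eigenvalues in question are real and nonnegative, so that
  taking \<open>Re\<close> loses nothing.
\<close>

definition singular_values :: "complex mat \<Rightarrow> real list" where
  "singular_values A = rev (sorted_list_of_multiset
     (image_mset (\<lambda>z. sqrt (Re z)) (proots (char_poly (mat_adjoint A * A)))))"

definition singular_value :: "complex mat \<Rightarrow> nat \<Rightarrow> real" where
  "singular_value A r = singular_values A ! (r - 1)"

definition singular_vectors :: "complex mat \<Rightarrow> real \<Rightarrow> complex vec \<Rightarrow> complex vec \<Rightarrow> bool" where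
  "singular_vectors A s u v \<longleftrightarrow>
     u \<in> carrier_vec (dim_row A) \<and> v \<in> carrier_vec (dim_col A) \<and>
     u \<bullet>c u = 1 \<and> v \<bullet>c v = 1 \<and>
     A *\<^sub>v v = of_real s \<cdot>\<^sub>v u \<and> mat_adjoint A *\<^sub>v u = of_real s \<cdot>\<^sub>v v"

definition is_pseudoinverse :: "complex mat \<Rightarrow> complex mat \<Rightarrow> bool" where
  "is_pseudoinverse A X \<longleftrightarrow>
     X \<in> carrier_mat (dim_col A) (dim_row A) \<and>
     A * X * A = A \<and> X * A * X = X \<and>
     mat_adjoint (A * X) = A * X \<and> mat_adjoint (X * A) = X * A"

definition pseudoinverse :: "complex mat \<Rightarrow> complex mat" where
  "pseudoinverse A = (THE X. is_pseudoinverse A X)"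

definition block_vec :: "nat \<Rightarrow> complex vec \<Rightarrow> nat \<Rightarrow> complex vec" where
  "block_vec n x j = vec n (\<lambda>a. x $ ((j - 1) * n + a))"

definition block_cols :: "nat \<Rightarrow> nat \<Rightarrow> complex vec \<Rightarrow> complex mat" where
  "block_cols n k x = mat_of_cols n (map (block_vec n x) [1..<k+1])"

definition theta :: "(nat \<Rightarrow> complex) \<Rightarrow> real \<Rightarrow> nat \<Rightarrow> nat \<Rightarrow> complex" where
  "theta \<mu> \<gamma> i j = of_real \<gamma> / (\<mu> i - \<mu> j)"

text \<open>For \<open>p = 1\<close> the sum is empty, so the first block is left unchanged.\<close>

definition hat_vec :: "nat \<Rightarrow> (nat \<Rightarrow> complex) \<Rightarrow> real \<Rightarrow> complex vec \<Rightarrow> nat \<Rightarrow> complex vec" where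
  "hat_vec n \<mu> \<gamma> x p = vec n (\<lambda>a. block_vec n x p $ a +
     (\<Sum>i = 1..p - 1. (-1) ^ i * (\<Prod>j = p - i..p - 1. theta \<mu> \<gamma> j p) * block_vec n x (p - i) $ a))"

definition hat_mat :: "nat \<Rightarrow> nat \<Rightarrow> (nat \<Rightarrow> complex) \<Rightarrow> real \<Rightarrow> complex vec \<Rightarrow> complex mat" where
  "hat_mat n k \<mu> \<gamma> x = mat_of_cols n (map (hat_vec n \<mu> \<gamma> x) [1..<k+1])"

text \<open>
  \<open>weight_coeff m w z j\<close> is \<open>(1 / w(|z|)) (cnj z / |z|)\<^sup>j w\<^sub>j\<close>. For \<open>z = 0\<close> the library's
  \<open>0 / 0 = 0\<close> and \<open>0 ^ 0 = 1\<close> give the intended reading: the power is 1 for \<open>j = 0\<close>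
  and 0 for \<open>j \<ge> 1\<close>.
\<close>

definition weight_poly :: "nat \<Rightarrow> (nat \<Rightarrow> real) \<Rightarrow> real \<Rightarrow> real" where
  "weight_poly m w x = (\<Sum>j\<le>m. w j * x ^ j)"

definition weight_coeff :: "nat \<Rightarrow> (nat \<Rightarrow> real) \<Rightarrow> complex \<Rightarrow> nat \<Rightarrow> complex" where
  "weight_coeff m w z j =
     1 / of_real (weight_poly m w (cmod z)) * (cnj z / of_real (cmod z)) ^ j * of_real (w j)"

definition alpha :: "nat \<Rightarrow> (nat \<Rightarrow> real) \<Rightarrow> (nat \<Rightarrow> complex) \<Rightarrow> nat \<Rightarrow> nat \<Rightarrow> complex" where
  "alpha m w \<mu> i s = 1 / of_real (weight_poly m w (cmod (\<mu> i))) *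
     (\<Sum>j\<le>m. (cnj (\<mu> i) / of_real (cmod (\<mu> i))) ^ j * \<mu> s ^ j * of_real (w j))"

definition beta :: "nat \<Rightarrow> nat \<Rightarrow> (nat \<Rightarrow> real) \<Rightarrow> (nat \<Rightarrow> complex) \<Rightarrow> nat \<Rightarrow> complex" where
  "beta k m w \<mu> s = 1 / of_nat k * (\<Sum>i = 1..k. alpha m w \<mu> i s)"

definition Delta_mat ::
  "nat \<Rightarrow> nat \<Rightarrow> nat \<Rightarrow> (nat \<Rightarrow> real) \<Rightarrow> (nat \<Rightarrow> complex) \<Rightarrow> real \<Rightarrow> real \<Rightarrow>
   complex vec \<Rightarrow> complex vec \<Rightarrow> complex mat" where
  "Delta_mat n k m w \<mu> \<gamma> s u v =
     (- of_real s) \<cdot>\<^sub>m (hat_mat n k \<mu> \<gamma> u * mat_diag k (\<lambda>i. 1 / beta k m w \<mu> (i + 1)) *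
                      pseudoinverse (hat_mat n k \<mu> \<gamma> v))"

definition Delta_coeff ::
  "nat \<Rightarrow> nat \<Rightarrow> (nat \<Rightarrow> real) \<Rightarrow> (nat \<Rightarrow> complex) \<Rightarrow> complex mat \<Rightarrow> nat \<Rightarrow> complex mat" where
  "Delta_coeff k m w \<mu> D j = (1 / of_nat k * (\<Sum>i = 1..k. weight_coeff m w (\<mu> i) j)) \<cdot>\<^sub>m D"

end

(*
  By Newton's interpolation formula, the combinations defining the hatted vectors undo the block
  lower triangular coupling in F: for every x, P(mu_p) applied to the p-th hatted block of x is the
  p-th hatted block of F x.  Hence P(mu_p) hat v_p = s hat u_p.  The matrix hat V is V times a unit
  upper triangular matrix, so it has full column rank, its pseudoinverse is a left inverse, and
  Delta hat v_p = -(s / beta_p) hat u_p.  The weights are arranged so that Delta(mu_p) = beta_p Delta,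
  and the two contributions cancel.
*)
theory Submission
  imports Defs
begin

subsection \<open>Newton interpolation\<close>

text \<open>When \<open>d\<close> holds divided differences, the two sums are the Newton forms of
  the interpolants on the nodes \<open>x (Suc j), ..., x (Suc j + t)\<close> and
  \<open>x j, ..., x (j + t)\<close>. They agree at the shared nodes, so their difference is a
  multiple of the product over these, and the recursion rewrites the difference of the leading
  coefficients. The recursion has its denominators cleared, so the argument stays within ring
  identities.\<close>

lemma newton_sum_shift:
  fixes d :: "nat \<Rightarrow> nat \<Rightarrow> 'a::comm_ring_1"
  assumes rec: "\<And>i t. \<lbrakk>lo \<le> i; i + Suc t \<le> hi\<rbrakk> \<Longrightarrow>
      (x i - x (i + Suc t)) * d i (Suc t) = d i t - d (Suc i) t"
    and "lo \<le> j" "j + Suc t \<le> hi"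
  shows "(\<Sum>r\<le>t. d (Suc j) r * (\<Prod>l = Suc j..<Suc j + r. z - x l))
       - (\<Sum>r\<le>t. d j r * (\<Prod>l = j..<j + r. z - x l))
       = (x (j + Suc t) - x j) * d j (Suc t) * (\<Prod>l = Suc j..<Suc j + t. z - x l)"
  using assms(3)
proof (induction t)
  case 0
  show ?case using rec[of j 0] \<open>lo \<le> j\<close> 0 by (simp add: algebra_simps)
next
  case (Suc t)
  define S where "S = (\<Sum>r\<le>t. d (Suc j) r * (\<Prod>l = Suc j..<Suc j + r. z - x l))"
  define S' where "S' = (\<Sum>r\<le>t. d j r * (\<Prod>l = j..<j + r. z - x l))"
  define R where "R = (\<Prod>l = Suc j..<Suc j + t. z - x l)"
  \<comment> \<open>The two new products share the factor \<open>R\<close>. The factor left over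
    belongs to the last node in one and to the first node in the other.\<close>
  have P1: "(\<Prod>l = Suc j..<Suc j + Suc t. z - x l) = R * (z - x (j + Suc t))"
    unfolding R_def by simp
  have P2: "(\<Prod>l = j..<j + Suc t. z - x l) = (z - x j) * R"
    unfolding R_def by (subst prod.atLeast_Suc_lessThan) auto
  have IH: "S - S' = (x (j + Suc t) - x j) * d j (Suc t) * R"
    unfolding S_def S'_def R_def using Suc by simp
  have r: "(x j - x (j + Suc (Suc t))) * d j (Suc (Suc t)) = d j (Suc t) - d (Suc j) (Suc t)"
    using rec[of j "Suc t"] \<open>lo \<le> j\<close> Suc.prems by simp
  have "(S + d (Suc j) (Suc t) * (R * (z - x (j + Suc t)))) - (S' + d j (Suc t) * ((z - x j) * R))
      = (S - S') + R * (d (Suc j) (Suc t) * (z - x (j + Suc t)) - d j (Suc t) * (z - x j))"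
    by (simp add: algebra_simps)
  \<comment> \<open>The induction hypothesis contributes exactly what turns \<open>z - x j\<close>
    into \<open>z - x (j + Suc t)\<close> in the second term, so both terms now carry the same
    product.\<close>
  also have "\<dots> = - (d j (Suc t) - d (Suc j) (Suc t)) * (R * (z - x (j + Suc t)))"
    unfolding IH by (simp add: algebra_simps)
  also have "\<dots> = (x (j + Suc (Suc t)) - x j) * d j (Suc (Suc t)) * (R * (z - x (j + Suc t)))"
    unfolding r[symmetric] by (simp add: algebra_simps)
  finally show ?case
    unfolding sum.atMost_Suc P1 P2 S_def S'_def .
qed

text \<open>The value of the Newton form at its last node does not change when the first node is
  dropped. Repeating this leaves that last node alone, where the form is the constant
  \<open>d (j + t) 0\<close>.\<close>

lemma newton_interpolation:
  fixes d :: "nat \<Rightarrow> nat \<Rightarrow> 'a::comm_ring_1"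
  assumes rec: "\<And>i t. \<lbrakk>lo \<le> i; i + Suc t \<le> hi\<rbrakk> \<Longrightarrow>
      (x i - x (i + Suc t)) * d i (Suc t) = d i t - d (Suc i) t"
    and "lo \<le> j" "j + t \<le> hi"
  shows "(\<Sum>r\<le>t. d j r * (\<Prod>l = j..<j + r. x (j + t) - x l)) = d (j + t) 0"
  using assms(2,3)
proof (induction t arbitrary: j)
  case 0
  then show ?case by simp
next
  case (Suc t)
  let ?z = "x (j + Suc t)"
  have P: "(\<Prod>l = j..<j + Suc t. ?z - x l) = (?z - x j) * (\<Prod>l = Suc j..<Suc j + t. ?z - x l)"
    by (subst prod.atLeast_Suc_lessThan) auto
  \<comment> \<open>At \<open>z = x (j + Suc t)\<close> the factor
    \<open>x (j + Suc t) - x j\<close> of the shift identity is \<open>z - x j\<close>, so its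
    right-hand side is the last term of the longer sum.\<close>
  have "(\<Sum>r\<le>Suc t. d j r * (\<Prod>l = j..<j + r. ?z - x l))
      = (\<Sum>r\<le>t. d (Suc j) r * (\<Prod>l = Suc j..<Suc j + r. ?z - x l))"
    using newton_sum_shift[OF rec, of lo hi j t ?z] Suc.prems
    unfolding sum.atMost_Suc P by (simp add: algebra_simps)
  also have "\<dots> = d (j + Suc t) 0"
    using Suc.IH[of "Suc j"] Suc.prems by simp
  finally show ?case .
qed

subsection \<open>The pseudoinverse of a matrix of full column rank\<close>

lemma mat_adjoint_carrier [simp]: "A \<in> carrier_mat n k \<Longrightarrow> mat_adjoint A \<in> carrier_mat k n"
  unfolding mat_adjoint_def by auto

lemma mat_adjoint_dim [simp]:
  "dim_row (mat_adjoint A) = dim_col A" "dim_col (mat_adjoint A) = dim_row A"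
  unfolding mat_adjoint_def by auto

lemma mat_adjoint_index:
  assumes "A \<in> carrier_mat n k" "i < k" "j < n"
  shows "mat_adjoint A $$ (i, j) = conjugate (A $$ (j, i))"
  using assms unfolding mat_adjoint_def by (auto simp: mat_of_rows_index)

lemma mat_adjoint_mult:
  fixes A B :: "complex mat"
  assumes "A \<in> carrier_mat n k" "B \<in> carrier_mat k l"
  shows "mat_adjoint (A * B) = mat_adjoint B * mat_adjoint A"
proof (rule eq_matI)
  note AB = mult_carrier_mat[OF assms]
  fix i j assume "i < dim_row (mat_adjoint B * mat_adjoint A)"
    "j < dim_col (mat_adjoint B * mat_adjoint A)"
  then have ij: "i < l" "j < n" using assms by (auto simp: mat_adjoint_def)
  show "mat_adjoint (A * B) $$ (i, j) = (mat_adjoint B * mat_adjoint A) $$ (i, j)"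
    using assms ij mat_adjoint_carrier[OF assms(1)] mat_adjoint_carrier[OF assms(2)]
    by (subst mat_adjoint_index[OF AB ij])
      (auto simp: scalar_prod_def mat_adjoint_index[OF assms(1)] mat_adjoint_index[OF assms(2)]
        mult.commute intro!: sum.cong)
qed (use assms in \<open>auto simp: mat_adjoint_def\<close>)

lemma mat_adjoint_adjoint:
  fixes A :: "complex mat"
  assumes "A \<in> carrier_mat n k"
  shows "mat_adjoint (mat_adjoint A) = A"
proof (rule eq_matI)
  fix i j assume ij: "i < dim_row A" "j < dim_col A"
  then show "mat_adjoint (mat_adjoint A) $$ (i, j) = A $$ (i, j)"
    using assms mat_adjoint_index[OF mat_adjoint_carrier[OF assms], of i j]
    by (auto simp: mat_adjoint_index[OF assms])
qed (use assms in \<open>auto simp: mat_adjoint_def\<close>)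

lemma mat_adjoint_one: "mat_adjoint (1\<^sub>m n :: complex mat) = 1\<^sub>m n"
proof (rule eq_matI)
  fix i j assume "i < dim_row (1\<^sub>m n :: complex mat)" "j < dim_col (1\<^sub>m n :: complex mat)"
  then show "mat_adjoint (1\<^sub>m n) $$ (i, j) = (1\<^sub>m n :: complex mat) $$ (i, j)"
    by (subst mat_adjoint_index[of _ n n]) auto
qed (auto simp: mat_adjoint_def)

text \<open>Penrose's argument: \<open>A * X\<close> and \<open>A * Y\<close> are self-adjoint
  projections with the same range, hence equal, and likewise \<open>X * A\<close> and
  \<open>Y * A\<close>. Then \<open>X = X * A * X = Y * A * X = Y * A * Y = Y\<close>. Uniqueness
  gives access to \<open>pseudoinverse\<close>, which is a definite description.\<close>

lemma is_pseudoinverse_unique: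
  assumes X: "is_pseudoinverse A X" and Y: "is_pseudoinverse A Y"
  shows "X = Y"
proof -
  obtain n k where A: "A \<in> carrier_mat n k" by auto
  then have Xc: "X \<in> carrier_mat k n" and Yc: "Y \<in> carrier_mat k n"
    using X Y unfolding is_pseudoinverse_def by auto
  note c = mult_carrier_mat[OF A Xc] mult_carrier_mat[OF A Yc]
    mult_carrier_mat[OF Xc A] mult_carrier_mat[OF Yc A]
  have x: "A * X * A = A" "X * A * X = X" "mat_adjoint (A * X) = A * X" "mat_adjoint (X * A) = X * A"
    and y: "A * Y * A = A" "Y * A * Y = Y" "mat_adjoint (A * Y) = A * Y" "mat_adjoint (Y * A) = Y * A"
    using X Y unfolding is_pseudoinverse_def by auto
  have "A * Y = (A * X) * (A * Y)"
    using x(1) assoc_mult_mat[OF c(1) A Yc] by simp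
  \<comment> \<open>The adjoint reverses the product and fixes both factors.\<close>
  also have "\<dots> = mat_adjoint ((A * Y) * (A * X))"
    unfolding mat_adjoint_mult[OF c(2) c(1)] x y ..
  also have "(A * Y) * (A * X) = A * X"
    using y(1) assoc_mult_mat[OF c(2) A Xc] by simp
  finally have AY: "A * Y = A * X" unfolding x .
  have "X * A = (X * A) * (Y * A)"
    using y(1) assoc_mult_mat[OF Xc A c(4)] assoc_mult_mat[OF A Yc A] by simp
  also have "\<dots> = mat_adjoint ((Y * A) * (X * A))"
    unfolding mat_adjoint_mult[OF c(4) c(3)] x y ..
  also have "(Y * A) * (X * A) = Y * A"
    using x(1) assoc_mult_mat[OF Yc A c(3)] assoc_mult_mat[OF A Xc A] by simp
  finally have XA: "X * A = Y * A" unfolding y .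
  have "X = Y * A * X" using x(2) XA by simp
  also have "\<dots> = Y * (A * Y)" using AY assoc_mult_mat[OF Yc A Xc] by simp
  also have "\<dots> = Y" using y(2) assoc_mult_mat[OF Yc A Yc] by simp
  finally show ?thesis .
qed

text \<open>The squared norm of \<open>y = A *\<^sub>v x\<close> is the pairing of
  \<open>mat_adjoint A *\<^sub>v y = 0\<close> with \<open>x\<close>.\<close>

lemma mult_adjoint_self_eq_zero:
  fixes A :: "complex mat"
  assumes A: "A \<in> carrier_mat n k" and x: "x \<in> carrier_vec k"
    and 0: "(mat_adjoint A * A) *\<^sub>v x = 0\<^sub>v k"
  shows "A *\<^sub>v x = 0\<^sub>v n"
proof -
  define y where "y = A *\<^sub>v x"
  have y: "y \<in> carrier_vec n" using A x unfolding y_def by auto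
  have "mat_adjoint A *\<^sub>v y = 0\<^sub>v k"
    using 0 assoc_mult_mat_vec[OF mat_adjoint_carrier[OF A] A x] unfolding y_def by simp
  then have ay: "(\<Sum>j<n. cnj (A $$ (j, i)) * y $ j) = 0" if "i < k" for i
  proof -
    have "(mat_adjoint A *\<^sub>v y) $ i = (\<Sum>j<n. cnj (A $$ (j, i)) * y $ j)"
      using that A y by (simp add: scalar_prod_def mat_adjoint_index[OF A] lessThan_atLeast0)
    with \<open>mat_adjoint A *\<^sub>v y = 0\<^sub>v k\<close> that show ?thesis by simp
  qed
  have "y \<bullet>c y = (\<Sum>j<n. y $ j * (\<Sum>i<k. cnj (A $$ (j, i)) * cnj (x $ i)))"
    using A x y unfolding scalar_prod_def
    by (auto simp: y_def scalar_prod_def lessThan_atLeast0 intro!: sum.cong)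
  also have "\<dots> = (\<Sum>j<n. \<Sum>i<k. cnj (x $ i) * (cnj (A $$ (j, i)) * y $ j))"
    unfolding sum_distrib_left by (simp add: mult_ac)
  also have "\<dots> = (\<Sum>i<k. cnj (x $ i) * (\<Sum>j<n. cnj (A $$ (j, i)) * y $ j))"
    unfolding sum_distrib_left by (rule sum.swap)
  also have "\<dots> = 0" using ay by simp
  finally show ?thesis using y unfolding y_def by simp
qed

text \<open>Injectivity makes the Gram matrix \<open>B = mat_adjoint A * A\<close> invertible. With
  \<open>C\<close> its inverse, \<open>C * mat_adjoint A\<close> is a left inverse of
  \<open>A\<close> and satisfies the four Penrose equations.\<close>

lemma pseudoinverse_mult_self:
  fixes A :: "complex mat"
  assumes A: "A \<in> carrier_mat n k"
    and inj: "\<And>x. \<lbrakk>x \<in> carrier_vec k; A *\<^sub>v x = 0\<^sub>v n\<rbrakk> \<Longrightarrow> x = 0\<^sub>v k"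
  shows "pseudoinverse A \<in> carrier_mat k n" "pseudoinverse A * A = 1\<^sub>m k"
proof -
  define B where "B = mat_adjoint A * A"
  note A' = mat_adjoint_carrier[OF A]
  have B: "B \<in> carrier_mat k k" unfolding B_def by (rule mult_carrier_mat[OF A' A])
  have "det B \<noteq> 0"
    using det_0_iff_vec_prod_zero_field[OF B] mult_adjoint_self_eq_zero[OF A] inj
    unfolding B_def by blast
  from det_non_zero_imp_unit[OF B this, of "()"]
  obtain C where C: "C \<in> carrier_mat k k" and CB: "C * B = 1\<^sub>m k" "B * C = 1\<^sub>m k"
    unfolding Units_def ring_mat_def by auto
  have B_adj: "mat_adjoint B = B"
    unfolding B_def by (simp add: mat_adjoint_mult[OF A' A] mat_adjoint_adjoint[OF A])
  have C': "mat_adjoint C \<in> carrier_mat k k" using C by simp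
  \<comment> \<open>The inverse of a self-adjoint matrix is self-adjoint:
    \<open>mat_adjoint C\<close> is a right inverse of \<open>B\<close>, hence equal to the left
    inverse \<open>C\<close>.\<close>
  have "B * mat_adjoint C = 1\<^sub>m k"
    using mat_adjoint_mult[OF C B] CB(1) B_adj mat_adjoint_one by metis
  then have "C * (B * mat_adjoint C) = C" using C by simp
  then have C_adj: "mat_adjoint C = C"
    using assoc_mult_mat[OF C B C'] CB(1) left_mult_one_mat[OF C'] by metis
  define X where "X = C * mat_adjoint A"
  have X: "X \<in> carrier_mat k n" unfolding X_def using C A' by auto
  have XA: "X * A = 1\<^sub>m k"
    unfolding X_def using assoc_mult_mat[OF C A' A] CB(1) B_def by simp
  have "mat_adjoint (A * X) = mat_adjoint X * mat_adjoint A"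
    by (rule mat_adjoint_mult[OF A X])
  also have "mat_adjoint X = A * C"
    unfolding X_def mat_adjoint_mult[OF C A'] mat_adjoint_adjoint[OF A] C_adj ..
  also have "A * C * mat_adjoint A = A * X"
    unfolding X_def by (rule assoc_mult_mat[OF A C A'])
  finally have "is_pseudoinverse A X"
    using A X XA assoc_mult_mat[OF A X A] mat_adjoint_one
    unfolding is_pseudoinverse_def by auto
  then have "pseudoinverse A = X"
    unfolding pseudoinverse_def using is_pseudoinverse_unique by blast
  then show "pseudoinverse A \<in> carrier_mat k n" "pseudoinverse A * A = 1\<^sub>m k"
    using X XA by auto
qed

text \<open>The rank is the size of a maximal independent subset of the set of columns, and a
  repeated column would leave that set with fewer than \<open>nc\<close> elements. Distinctness is
  what lets independence of the set of columns speak about the list of columns.\<close>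

lemma (in vec_space) full_rank_distinct_cols:
  assumes A: "A \<in> carrier_mat n nc" and "rank A = nc"
  shows "distinct (cols A)"
proof -
  obtain S where S: "maximal S (\<lambda>T. T \<subseteq> set (cols A) \<and> lin_indpt T)"
    using maximal_exists_superset[of "set (cols A)" "\<lambda>T. T \<subseteq> set (cols A) \<and> lin_indpt T" "{}"]
    by (auto simp: lin_dep_def)
  then have "card S \<le> card (set (cols A))"
    unfolding maximal_def by (intro card_mono) auto
  then have "length (cols A) \<le> card (set (cols A))"
    using rank_card_indpt[OF A S] assms by simp
  then show ?thesis
    using card_length[of "cols A"] by (intro card_distinct) simp
qed

lemma (in vec_space) full_rank_injective:
  assumes A: "A \<in> carrier_mat n nc" and r: "rank A = nc"
    and "x \<in> carrier_vec nc" "A *\<^sub>v x = 0\<^sub>v n"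
  shows "x = 0\<^sub>v nc"
  using lin_depI[OF A, of x] full_rank_distinct_cols[OF A r] full_rank_lin_indpt[OF A r] assms
  by blast

subsection \<open>The vectors $\hat x_p$\<close>

text \<open>The coefficient of block \<open>q\<close> in the hatted block \<open>p\<close>. The
  signs in \<open>hat_vec\<close> are absorbed by reversing the differences in \<open>theta\<close>;
  for \<open>q = p\<close> the product is empty and equals 1.\<close>

definition hat_coeff :: "(nat \<Rightarrow> complex) \<Rightarrow> real \<Rightarrow> nat \<Rightarrow> nat \<Rightarrow> complex" where
  "hat_coeff \<mu> \<gamma> q p = (\<Prod>l = q..<p. of_real \<gamma> / (\<mu> p - \<mu> l))"

lemma hat_vec_carrier [simp]: "hat_vec n \<mu> \<gamma> x p \<in> carrier_vec n"
  unfolding hat_vec_def by simp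

lemma block_vec_carrier [simp]: "block_vec n x p \<in> carrier_vec n"
  unfolding block_vec_def by simp

lemma hat_vec_eq_sum:
  assumes p: "1 \<le> p" and a: "a < n"
  shows "hat_vec n \<mu> \<gamma> x p $ a = (\<Sum>q = 1..p. hat_coeff \<mu> \<gamma> q p * block_vec n x q $ a)"
proof -
  have c: "(-1) ^ i * (\<Prod>j = p - i..p - 1. theta \<mu> \<gamma> j p) = hat_coeff \<mu> \<gamma> (p - i) p"
    if "i \<in> {1..p - 1}" for i
  proof -
    have "{p - i..p - 1} = {p - i..<p}" using that p by auto
    \<comment> \<open>There are exactly \<open>i\<close> factors because \<open>i \<le> p\<close>,
      so each \<open>theta\<close> receives one sign.\<close>
    moreover have "(-1::complex) ^ i = (\<Prod>j = p - i..<p. -1)"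
    proof -
      have "i \<le> p" using that by auto
      then show ?thesis by simp
    qed
    ultimately show ?thesis
      unfolding hat_coeff_def theta_def
      by (simp only: prod.distrib[symmetric])
        (metis (no_types) divide_minus_right minus_diff_eq mult_minus1)
  qed
  have "(\<Sum>i = 1..p - 1. (-1) ^ i * (\<Prod>j = p - i..p - 1. theta \<mu> \<gamma> j p) * block_vec n x (p - i) $ a)
      = (\<Sum>i = 1..p - 1. hat_coeff \<mu> \<gamma> (p - i) p * block_vec n x (p - i) $ a)"
    using c by (intro sum.cong) auto
  also have "\<dots> = (\<Sum>q = 1..p - 1. hat_coeff \<mu> \<gamma> q p * block_vec n x q $ a)"
    by (rule sum.reindex_bij_witness[of _ "\<lambda>q. p - q" "\<lambda>q. p - q"]) auto
  finally have "hat_vec n \<mu> \<gamma> x p $ a = block_vec n x p $ a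
      + (\<Sum>q = 1..p - 1. hat_coeff \<mu> \<gamma> q p * block_vec n x q $ a)"
    unfolding hat_vec_def using a by simp
  then show ?thesis
    using p by (cases p) (simp_all add: hat_coeff_def)
qed

lemma hat_vec_smult:
  assumes "x \<in> carrier_vec (n * k)" "p \<in> {1..k}"
  shows "hat_vec n \<mu> \<gamma> (c \<cdot>\<^sub>v x) p = c \<cdot>\<^sub>v hat_vec n \<mu> \<gamma> x p"
proof (rule eq_vecI)
  fix a assume "a < dim_vec (c \<cdot>\<^sub>v hat_vec n \<mu> \<gamma> x p)"
  then have a: "a < n" by (simp add: hat_vec_def)
  have "block_vec n (c \<cdot>\<^sub>v x) q $ a = c * block_vec n x q $ a" if "q \<in> {1..p}" for q
  proof -
    have "(q - 1) * n + a < (q - 1) * n + n" using a by simp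
    also have "\<dots> = q * n" using that by (cases q) auto
    also have "\<dots> \<le> n * k" using that assms by simp
    finally show ?thesis using a assms by (simp add: block_vec_def)
  qed
  then show "hat_vec n \<mu> \<gamma> (c \<cdot>\<^sub>v x) p $ a = (c \<cdot>\<^sub>v hat_vec n \<mu> \<gamma> x p) $ a"
    using a assms hat_vec_carrier[of n \<mu> \<gamma> x p]
    by (simp add: hat_vec_eq_sum sum_distrib_left mult_ac del: hat_vec_carrier)
qed (simp add: hat_vec_def)

text \<open>The sum over all columns is grouped into \<open>k\<close> consecutive runs of length
  \<open>n\<close>. The runs right of the diagonal block vanish, and each remaining run is one block
  applied to one block of \<open>x\<close>.\<close>

lemma F_mat_mult_index:
  assumes P: "\<And>i t. divided_diff P \<mu> i t \<in> carrier_mat n n"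
    and x: "x \<in> carrier_vec (n * k)" and i: "i \<in> {1..k}" and a: "a < n"
  shows "block_vec n (F_mat n k P \<mu> \<gamma> *\<^sub>v x) i $ a
    = (\<Sum>j = 1..i. of_real \<gamma> ^ (i - j) * (divided_diff P \<mu> j (i - j) *\<^sub>v block_vec n x j) $ a)"
proof -
  let ?F = "F_mat n k P \<mu> \<gamma>"
  define r where "r = (i - 1) * n + a"
  have "r < (i - 1) * n + n" using a unfolding r_def by simp
  also have "\<dots> = i * n" using i by (cases i) auto
  also have "\<dots> \<le> n * k" using i by simp
  finally have r: "r < n * k" .
  have rd: "r div n = i - 1" "r mod n = a" using a unfolding r_def by auto
  define g where "g j = of_real \<gamma> ^ (i - j) * (divided_diff P \<mu> j (i - j) *\<^sub>v block_vec n x j) $ a" for j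
  \<comment> \<open>Runs are numbered from 0 and blocks from 1, so run \<open>j\<close> belongs to
    block \<open>Suc j\<close>, and \<open>j < i\<close> means that this block is on or below the
    diagonal.\<close>
  have inner: "(\<Sum>c\<in>{j * n..<j * n + n}. ?F $$ (r, c) * x $ c) = (if j < i then g (Suc j) else 0)"
    if j: "j < k" for j
  proof -
    have "(\<Sum>c\<in>{j * n..<j * n + n}. ?F $$ (r, c) * x $ c)
        = (\<Sum>b\<in>{0..<n}. ?F $$ (r, j * n + b) * x $ (j * n + b))"
      by (rule sum.reindex_bij_witness[of _ "\<lambda>b. j * n + b" "\<lambda>c. c - j * n"]) auto
    also have "\<dots> = (\<Sum>b\<in>{0..<n}. (if j < i then of_real \<gamma> ^ (i - Suc j) *
          (divided_diff P \<mu> (Suc j) (i - Suc j) $$ (a, b) * x $ (j * n + b)) else 0))"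
    proof (rule sum.cong[OF refl])
      fix b assume "b \<in> {0..<n}"
      then have b: "b < n" by simp
      have "j * n + b < Suc j * n" using b by simp
      also have "\<dots> \<le> n * k" using j by (metis Suc_leI mult.commute mult_le_mono1)
      finally have jb: "j * n + b < n * k" .
      have jd: "(j * n + b) div n = j" "(j * n + b) mod n = b" using b by auto
      show "?F $$ (r, j * n + b) * x $ (j * n + b) = (if j < i then of_real \<gamma> ^ (i - Suc j) *
          (divided_diff P \<mu> (Suc j) (i - Suc j) $$ (a, b) * x $ (j * n + b)) else 0)"
        using r jb rd jd i a b P[of "Suc j" "i - Suc j"]
        unfolding F_mat_def Let_def by auto
    qed
    also have "\<dots> = (if j < i then g (Suc j) else 0)"
      using a P[of "Suc j" "i - Suc j"]
      by (auto simp: g_def scalar_prod_def block_vec_def sum_distrib_left)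
    finally show ?thesis .
  qed
  have "block_vec n (?F *\<^sub>v x) i $ a = (?F *\<^sub>v x) $ r"
    unfolding block_vec_def r_def using a by simp
  also have "\<dots> = (\<Sum>c<k * n. ?F $$ (r, c) * x $ c)"
    using r x by (auto simp: F_mat_def scalar_prod_def lessThan_atLeast0 mult.commute intro!: sum.cong)
  also have "\<dots> = (\<Sum>j<k. \<Sum>c\<in>{j * n..<j * n + n}. ?F $$ (r, c) * x $ c)"
    by (rule sum.nat_group[symmetric])
  also have "\<dots> = (\<Sum>j<k. if j < i then g (Suc j) else 0)"
    using inner by simp
  also have "\<dots> = (\<Sum>j\<in>{j \<in> {..<k}. j < i}. g (Suc j))"
    by (rule sum.inter_filter[symmetric]) simp
  also have "\<dots> = (\<Sum>j = 1..i. g j)"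
    using i by (intro sum.reindex_bij_witness[of _ "\<lambda>j. j - 1" Suc]) auto
  finally show ?thesis unfolding g_def .
qed

text \<open>
  Multiplying by \<open>hat_coeff\<close> turns the Newton interpolation formula at \<open>\<mu> p\<close> into the following
  identity, since \<open>hat_coeff \<mu> \<gamma> q p * \<gamma> ^ (q - j)\<close> is \<open>hat_coeff \<mu> \<gamma> j p\<close> times the Newton
  polynomial with nodes \<open>\<mu> j, \<dots>, \<mu> (q - 1)\<close>, evaluated at \<open>\<mu> p\<close>.
\<close>

lemma hat_coeff_newton:
  assumes inj: "inj_on \<mu> {1..k}" and j: "1 \<le> j" "j \<le> p" "p \<le> k"
    and rec: "\<And>i t. \<lbrakk>1 \<le> i; i + Suc t \<le> k\<rbrakk> \<Longrightarrow>
      (\<mu> i - \<mu> (i + Suc t)) * d i (Suc t) = d i t - d (Suc i) t"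
  shows "(\<Sum>q = j..p. hat_coeff \<mu> \<gamma> q p * (of_real \<gamma> ^ (q - j) * d j (q - j)))
    = hat_coeff \<mu> \<gamma> j p * d p 0"
proof -
  have split: "hat_coeff \<mu> \<gamma> q p * of_real \<gamma> ^ (q - j)
      = hat_coeff \<mu> \<gamma> j p * (\<Prod>l = j..<q. \<mu> p - \<mu> l)" if q: "q \<in> {j..p}" for q
  proof -
    \<comment> \<open>Each factor \<open>\<gamma>\<close> is divided and multiplied by
      \<open>\<mu> p - \<mu> l\<close>, which is nonzero because \<open>l < q \<le> p\<close>. The
      quotients extend \<open>hat_coeff \<mu> \<gamma> q p\<close> down to \<open>j\<close>.\<close>
    have "of_real \<gamma> ^ (q - j) = (\<Prod>l = j..<q. of_real \<gamma> / (\<mu> p - \<mu> l) * (\<mu> p - \<mu> l))"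
    proof -
      have "\<mu> p - \<mu> l \<noteq> 0" if "l \<in> {j..<q}" for l
        using that q j inj_onD[OF inj, of p l] by auto
      then have "(\<Prod>l = j..<q. of_real \<gamma> / (\<mu> p - \<mu> l) * (\<mu> p - \<mu> l)) = (\<Prod>l = j..<q. of_real \<gamma>)"
        by (intro prod.cong) auto
      then show ?thesis by simp
    qed
    moreover have "hat_coeff \<mu> \<gamma> j p = (\<Prod>l = j..<q. of_real \<gamma> / (\<mu> p - \<mu> l)) * hat_coeff \<mu> \<gamma> q p"
      unfolding hat_coeff_def using q by (simp add: prod.atLeastLessThan_concat)
    ultimately show ?thesis unfolding prod.distrib by (simp only: mult_ac)
  qed
  have "(\<Sum>q = j..p. hat_coeff \<mu> \<gamma> q p * (of_real \<gamma> ^ (q - j) * d j (q - j)))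
      = (\<Sum>q = j..p. hat_coeff \<mu> \<gamma> j p * (d j (q - j) * (\<Prod>l = j..<q. \<mu> p - \<mu> l)))"
  proof (rule sum.cong[OF refl])
    fix q assume "q \<in> {j..p}"
    from split[OF this]
    show "hat_coeff \<mu> \<gamma> q p * (of_real \<gamma> ^ (q - j) * d j (q - j))
      = hat_coeff \<mu> \<gamma> j p * (d j (q - j) * (\<Prod>l = j..<q. \<mu> p - \<mu> l))"
      by (metis mult.assoc mult.commute)
  qed
  also have "\<dots> = hat_coeff \<mu> \<gamma> j p * (\<Sum>r\<le>p - j. d j r * (\<Prod>l = j..<j + r. \<mu> p - \<mu> l))"
    unfolding sum_distrib_left
    by (rule sum.reindex_bij_witness[of _ "\<lambda>r. j + r" "\<lambda>q. q - j"]) (use j in auto)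
  also have "(\<Sum>r\<le>p - j. d j r * (\<Prod>l = j..<j + r. \<mu> p - \<mu> l)) = d p 0"
    using newton_interpolation[of 1 k \<mu> d j "p - j"] rec j by simp
  finally show ?thesis .
qed

lemma divided_diff_carrier:
  assumes "\<And>z. P z \<in> carrier_mat n n"
  shows "divided_diff P \<mu> i t \<in> carrier_mat n n"
proof (induction t arbitrary: i)
  case (Suc t)
  show ?case using Suc[of i] Suc[of "Suc i"] by (auto simp del: One_nat_def)
qed (use assms in auto)

text \<open>Both sides are combinations of matrices applied to the blocks of \<open>x\<close>. On
  the right, collecting everything applied to block \<open>j\<close> gives a Newton expansion at
  \<open>\<mu> p\<close>, which sums to \<open>P (\<mu> p)\<close> with the coefficient from the
  left.\<close>

lemma eval_mult_hat_vec:
  assumes P: "\<And>z. P z \<in> carrier_mat n n" and inj: "inj_on \<mu> {1..k}"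
    and x: "x \<in> carrier_vec (n * k)" and p: "p \<in> {1..k}"
  shows "P (\<mu> p) *\<^sub>v hat_vec n \<mu> \<gamma> x p = hat_vec n \<mu> \<gamma> (F_mat n k P \<mu> \<gamma> *\<^sub>v x) p"
proof (rule eq_vecI)
  have D: "divided_diff P \<mu> i t \<in> carrier_mat n n" for i t
    using P by (rule divided_diff_carrier)
  let ?D = "divided_diff P \<mu>" and ?c = "\<lambda>q. hat_coeff \<mu> \<gamma> q p" and ?x = "block_vec n x"
  fix a assume "a < dim_vec (hat_vec n \<mu> \<gamma> (F_mat n k P \<mu> \<gamma> *\<^sub>v x) p)"
  then have a: "a < n" by (simp add: hat_vec_def)
  \<comment> \<open>For a fixed vector \<open>y\<close> and entry \<open>a\<close>, the matrix
    recursion becomes a scalar one, so the scalar Newton identity applies.\<close>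
  have rec: "(\<mu> i - \<mu> (i + Suc t)) * (?D i (Suc t) *\<^sub>v y) $ a = (?D i t *\<^sub>v y) $ a - (?D (Suc i) t *\<^sub>v y) $ a"
    if "1 \<le> i" "i + Suc t \<le> k" and y: "y \<in> carrier_vec n" for i t y
  proof -
    have "\<mu> i - \<mu> (i + Suc t) \<noteq> 0"
      using that inj_onD[OF inj, of i "i + Suc t"] by auto
    moreover have "(?D i (Suc t) *\<^sub>v y) $ a
        = (\<Sum>b<n. 1 / (\<mu> i - \<mu> (i + Suc t)) * (?D i t $$ (a, b) - ?D (Suc i) t $$ (a, b)) * y $ b)"
      using a y D[of i t] D[of "Suc i" t]
      by (auto simp: scalar_prod_def lessThan_atLeast0 intro!: sum.cong)
    moreover have "(?D i t *\<^sub>v y) $ a = (\<Sum>b<n. ?D i t $$ (a, b) * y $ b)" for i t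
      using a y D[of i t] by (auto simp: scalar_prod_def lessThan_atLeast0 intro!: sum.cong)
    ultimately show ?thesis
      by (simp add: sum_distrib_left del: divided_diff.simps)
        (simp add: left_diff_distrib sum_subtractf)
  qed
  have "hat_vec n \<mu> \<gamma> (F_mat n k P \<mu> \<gamma> *\<^sub>v x) p $ a
      = (\<Sum>q = 1..p. ?c q * (\<Sum>j = 1..q. of_real \<gamma> ^ (q - j) * (?D j (q - j) *\<^sub>v ?x j) $ a))"
    using p a by (subst hat_vec_eq_sum) (auto simp: F_mat_mult_index[OF D x])
  also have "\<dots> = (\<Sum>q = 1..p. \<Sum>j = 1..q. ?c q * (of_real \<gamma> ^ (q - j) * (?D j (q - j) *\<^sub>v ?x j) $ a))"
    unfolding sum_distrib_left ..
  \<comment> \<open>Exchange of the two sums over the triangle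
    \<open>1 \<le> j \<le> q \<le> p\<close>.\<close>
  also have "\<dots> = (\<Sum>j = 1..p. \<Sum>q = j..p. ?c q * (of_real \<gamma> ^ (q - j) * (?D j (q - j) *\<^sub>v ?x j) $ a))"
    by (subst (1 2) sum.Sigma, simp, simp, simp, simp)
      (rule sum.reindex_bij_witness[of _ "\<lambda>(j, q). (q, j)" "\<lambda>(q, j). (j, q)"], auto)
  also have "\<dots> = (\<Sum>j = 1..p. ?c j * (P (\<mu> p) *\<^sub>v ?x j) $ a)"
  proof (rule sum.cong[OF refl])
    fix j assume j: "j \<in> {1..p}"
    show "(\<Sum>q = j..p. ?c q * (of_real \<gamma> ^ (q - j) * (?D j (q - j) *\<^sub>v ?x j) $ a))
        = ?c j * (P (\<mu> p) *\<^sub>v ?x j) $ a"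
      using hat_coeff_newton[OF inj, of j p "\<lambda>i t. (?D i t *\<^sub>v ?x j) $ a" \<gamma>] j p rec by simp
  qed
  also have "\<dots> = (\<Sum>j = 1..p. \<Sum>b<n. P (\<mu> p) $$ (a, b) * (?c j * ?x j $ b))"
    using a P[of "\<mu> p"]
    by (auto simp: scalar_prod_def block_vec_def lessThan_atLeast0 sum_distrib_left mult_ac intro!: sum.cong)
  also have "\<dots> = (\<Sum>b<n. P (\<mu> p) $$ (a, b) * (\<Sum>j = 1..p. ?c j * ?x j $ b))"
    unfolding sum_distrib_left by (rule sum.swap)
  also have "\<dots> = (\<Sum>b<n. P (\<mu> p) $$ (a, b) * hat_vec n \<mu> \<gamma> x p $ b)"
    using p by (intro sum.cong) (auto simp: hat_vec_eq_sum)
  also have "\<dots> = (P (\<mu> p) *\<^sub>v hat_vec n \<mu> \<gamma> x p) $ a"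
    using a P[of "\<mu> p"] hat_vec_carrier[of n \<mu> \<gamma> x p]
    by (simp add: scalar_prod_def lessThan_atLeast0 del: hat_vec_carrier)
  finally show "(P (\<mu> p) *\<^sub>v hat_vec n \<mu> \<gamma> x p) $ a
      = hat_vec n \<mu> \<gamma> (F_mat n k P \<mu> \<gamma> *\<^sub>v x) p $ a" ..
qed (use P[of "\<mu> p"] in \<open>auto simp: hat_vec_def\<close>)

section \<open>Injectivity of the matrix of hatted blocks\<close>

lemma hat_mat_carrier [simp]: "hat_mat n k \<mu> \<gamma> x \<in> carrier_mat n k"
  unfolding hat_mat_def by (auto simp: mat_of_cols_def)

lemma hat_mat_dim [simp]:
  "dim_row (hat_mat n k \<mu> \<gamma> x) = n" "dim_col (hat_mat n k \<mu> \<gamma> x) = k"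
  using hat_mat_carrier[of n k \<mu> \<gamma> x] unfolding carrier_mat_def by auto

lemma block_cols_carrier [simp]: "block_cols n k x \<in> carrier_mat n k"
  unfolding block_cols_def by (auto simp: mat_of_cols_def)

lemma col_hat_mat: "p \<in> {1..k} \<Longrightarrow> col (hat_mat n k \<mu> \<gamma> x) (p - 1) = hat_vec n \<mu> \<gamma> x p"
  unfolding hat_mat_def by (subst col_mat_of_cols) (auto simp del: upt_Suc)

text \<open>The hatted matrix is \<open>block_cols n k x * T\<close> with \<open>T\<close> unit
  upper triangular, and an invertible right factor preserves injectivity.\<close>

lemma hat_mat_injective:
  assumes inj: "\<And>y. \<lbrakk>y \<in> carrier_vec k; block_cols n k x *\<^sub>v y = 0\<^sub>v n\<rbrakk> \<Longrightarrow> y = 0\<^sub>v k"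
    and y: "y \<in> carrier_vec k" "hat_mat n k \<mu> \<gamma> x *\<^sub>v y = 0\<^sub>v n"
  shows "y = 0\<^sub>v k"
proof -
  define T where "T = mat k k (\<lambda>(i, j). if i \<le> j then hat_coeff \<mu> \<gamma> (Suc i) (Suc j) else 0)"
  have T: "T \<in> carrier_mat k k" unfolding T_def by simp
  have "upper_triangular T" unfolding T_def by (auto intro!: upper_triangularI)
  \<comment> \<open>The diagonal entries are empty products.\<close>
  moreover have "diag_mat T = replicate k 1"
    by (rule nth_equalityI) (auto simp: diag_mat_def T_def hat_coeff_def)
  ultimately have det: "det T \<noteq> 0"
    using det_upper_triangular[OF _ T] by simp
  have "hat_mat n k \<mu> \<gamma> x = block_cols n k x * T"
  proof (rule eq_matI)
    fix a j assume "a < dim_row (block_cols n k x * T)" "j < dim_col (block_cols n k x * T)"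
    then have aj: "a < n" "j < k" using T block_cols_carrier[of n k x] by auto
    have "(block_cols n k x * T) $$ (a, j)
        = (\<Sum>i<k. if i \<le> j then hat_coeff \<mu> \<gamma> (Suc i) (Suc j) * block_vec n x (Suc i) $ a else 0)"
      using aj block_cols_carrier[of n k x]
      by (auto simp: scalar_prod_def T_def block_cols_def mat_of_cols_index lessThan_atLeast0
          simp del: upt_Suc intro!: sum.cong)
    also have "\<dots> = (\<Sum>i\<in>{i \<in> {..<k}. i \<le> j}. hat_coeff \<mu> \<gamma> (Suc i) (Suc j) * block_vec n x (Suc i) $ a)"
      by (rule sum.inter_filter[symmetric]) simp
    also have "\<dots> = (\<Sum>q = 1..Suc j. hat_coeff \<mu> \<gamma> q (Suc j) * block_vec n x q $ a)"
      using aj by (intro sum.reindex_bij_witness[of _ "\<lambda>j. j - 1" Suc]) auto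
    finally show "hat_mat n k \<mu> \<gamma> x $$ (a, j) = (block_cols n k x * T) $$ (a, j)"
      using aj by (simp add: hat_mat_def mat_of_cols_index hat_vec_eq_sum del: upt_Suc)
  qed (use T in \<open>auto simp: hat_mat_def block_cols_def\<close>)
  then have "block_cols n k x *\<^sub>v (T *\<^sub>v y) = 0\<^sub>v n"
    using assoc_mult_mat_vec[OF block_cols_carrier T y(1)] y(2) by metis
  then have "T *\<^sub>v y = 0\<^sub>v k" using inj T y(1) by simp
  then show ?thesis using det det_0_iff_vec_prod_zero_field[OF T] y(1) by blast
qed

subsection \<open>The perturbation\<close>

lemma smult_mult_mat_vec:
  fixes A :: "'a::comm_ring_1 mat"
  assumes "A \<in> carrier_mat n k" "x \<in> carrier_vec k"
  shows "(c \<cdot>\<^sub>m A) *\<^sub>v x = c \<cdot>\<^sub>v (A *\<^sub>v x)"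
  using assms by (intro eq_vecI) (auto simp: scalar_prod_def sum_distrib_left mult.assoc)

lemma Delta_mat_carrier:
  assumes "pseudoinverse (hat_mat n k \<mu> \<gamma> v) \<in> carrier_mat k n"
  shows "Delta_mat n k m w \<mu> \<gamma> s u v \<in> carrier_mat n n"
  unfolding Delta_mat_def
  using assms mult_carrier_mat[OF mult_carrier_mat[OF hat_mat_carrier mat_diag_dim] assms] by simp

text \<open>The pseudoinverse is a left inverse, so it sends the \<open>p\<close>-th hatted block of
  \<open>v\<close> to a unit vector. The diagonal matrix scales this by
  \<open>1 / beta k m w \<mu> p\<close>, and the left factor picks out the \<open>p\<close>-th
  hatted block of \<open>u\<close>.\<close>

lemma Delta_mat_mult_hat_vec:
  assumes inj: "\<And>y. \<lbrakk>y \<in> carrier_vec k; hat_mat n k \<mu> \<gamma> v *\<^sub>v y = 0\<^sub>v n\<rbrakk> \<Longrightarrow> y = 0\<^sub>v k"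
    and p: "p \<in> {1..k}"
  shows "Delta_mat n k m w \<mu> \<gamma> s u v *\<^sub>v hat_vec n \<mu> \<gamma> v p
    = (- of_real s / beta k m w \<mu> p) \<cdot>\<^sub>v hat_vec n \<mu> \<gamma> u p"
proof -
  let ?U = "hat_mat n k \<mu> \<gamma> u" and ?V = "hat_mat n k \<mu> \<gamma> v"
  let ?B = "mat_diag k (\<lambda>i. 1 / beta k m w \<mu> (i + 1))"
  have X: "pseudoinverse ?V \<in> carrier_mat k n" "pseudoinverse ?V * ?V = 1\<^sub>m k"
    using pseudoinverse_mult_self[OF hat_mat_carrier] inj by blast+
  have p1: "p - 1 < k" using p by auto
  have UB: "?U * ?B \<in> carrier_mat n k" using mult_carrier_mat[OF hat_mat_carrier mat_diag_dim] .
  have UBX: "?U * ?B * pseudoinverse ?V \<in> carrier_mat n n" using mult_carrier_mat[OF UB X(1)] .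
  have "?U * ?B * pseudoinverse ?V * ?V = ?U * ?B"
    using assoc_mult_mat[OF UB X(1) hat_mat_carrier] X(2) right_mult_one_mat[OF UB] by metis
  \<comment> \<open>Comparison of one column of the matrix identity; block \<open>p\<close> sits in
    column \<open>p - 1\<close>.\<close>
  then have "(?U * ?B * pseudoinverse ?V) *\<^sub>v col ?V (p - 1) = col (?U * ?B) (p - 1)"
    using col_mult2[OF UBX hat_mat_carrier p1, of \<mu> \<gamma> v] by simp
  moreover have "col (?U * ?B) (p - 1) = (1 / beta k m w \<mu> p) \<cdot>\<^sub>v col ?U (p - 1)"
    using p
    by (intro eq_vecI) (auto simp: mat_diag_mult_right[OF hat_mat_carrier])
  ultimately have "(?U * ?B * pseudoinverse ?V) *\<^sub>v hat_vec n \<mu> \<gamma> v p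
      = (1 / beta k m w \<mu> p) \<cdot>\<^sub>v hat_vec n \<mu> \<gamma> u p"
    using col_hat_mat[OF p] by metis
  then show ?thesis
    unfolding Delta_mat_def
    by (subst smult_mult_mat_vec[OF UBX hat_vec_carrier]) (simp add: smult_smult_assoc)
qed

lemma sum_weight_coeff: "(\<Sum>j\<le>m. weight_coeff m w (\<mu> i) j * \<mu> p ^ j) = alpha m w \<mu> i p"
  unfolding alpha_def weight_coeff_def by (simp add: sum_distrib_left mult_ac)

text \<open>All coefficients of the perturbation are scalar multiples of the same matrix
  \<open>D\<close>, so its value at \<open>\<mu> p\<close> is a scalar polynomial value times
  \<open>D\<close>. Exchanging the sums over \<open>j\<close> and \<open>i\<close> shows this scalar
  to be the average of \<open>alpha m w \<mu> i p\<close> over \<open>i\<close>.\<close>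

lemma matpoly_eval_perturbed:
  assumes A: "\<And>j. j \<le> m \<Longrightarrow> A j \<in> carrier_mat n n" and D: "D \<in> carrier_mat n n"
  shows "matpoly_eval n m (\<lambda>j. A j + Delta_coeff k m w \<mu> D j) (\<mu> p)
    = matpoly_eval n m A (\<mu> p) + beta k m w \<mu> p \<cdot>\<^sub>m D"
proof (rule eq_matI)
  fix a b
  assume "a < dim_row (matpoly_eval n m A (\<mu> p) + beta k m w \<mu> p \<cdot>\<^sub>m D)"
    and "b < dim_col (matpoly_eval n m A (\<mu> p) + beta k m w \<mu> p \<cdot>\<^sub>m D)"
  then have ab: "a < n" "b < n" using D by auto
  have "(\<Sum>j\<le>m. 1 / of_nat k * (\<Sum>i = 1..k. weight_coeff m w (\<mu> i) j) * D $$ (a, b) * \<mu> p ^ j)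
      = (\<Sum>j\<le>m. \<Sum>i = 1..k. 1 / of_nat k * (weight_coeff m w (\<mu> i) j * \<mu> p ^ j) * D $$ (a, b))"
    by (simp add: sum_distrib_left sum_distrib_right mult_ac)
  also have "\<dots> = 1 / of_nat k * (\<Sum>i = 1..k. \<Sum>j\<le>m. weight_coeff m w (\<mu> i) j * \<mu> p ^ j) * D $$ (a, b)"
    by (subst sum.swap) (simp add: sum_distrib_left sum_distrib_right)
  also have "\<dots> = beta k m w \<mu> p * D $$ (a, b)"
    unfolding sum_weight_coeff beta_def ..
  finally have *: "(\<Sum>j\<le>m. 1 / of_nat k * (\<Sum>i = 1..k. weight_coeff m w (\<mu> i) j) * D $$ (a, b) * \<mu> p ^ j)
      = beta k m w \<mu> p * D $$ (a, b)" .
  have "matpoly_eval n m (\<lambda>j. A j + Delta_coeff k m w \<mu> D j) (\<mu> p) $$ (a, b)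
      = (\<Sum>j\<le>m. A j $$ (a, b) * \<mu> p ^ j
          + 1 / of_nat k * (\<Sum>i = 1..k. weight_coeff m w (\<mu> i) j) * D $$ (a, b) * \<mu> p ^ j)"
    using ab D unfolding matpoly_eval_def Delta_coeff_def
    by (auto simp: distrib_right intro!: sum.cong)
  then show "matpoly_eval n m (\<lambda>j. A j + Delta_coeff k m w \<mu> D j) (\<mu> p) $$ (a, b)
      = (matpoly_eval n m A (\<mu> p) + beta k m w \<mu> p \<cdot>\<^sub>m D) $$ (a, b)"
    using ab D * by (simp add: sum.distrib matpoly_eval_def)
qed (use D in \<open>auto simp: matpoly_eval_def\<close>)

theorem theorem3p2:
  fixes n m k :: nat and A :: "nat \<Rightarrow> complex mat" and w :: "nat \<Rightarrow> real"
    and \<mu> :: "nat \<Rightarrow> complex" and \<gamma> :: real and u v :: "complex vec"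
  defines "F \<equiv> F_mat n k (matpoly_eval n m A) \<mu> \<gamma>"
    and "\<rho> \<equiv> n * k - k + 1"
  defines "s \<equiv> singular_value F \<rho>"
  defines "\<Delta> \<equiv> Delta_mat n k m w \<mu> \<gamma> s u v"
  defines "Q \<equiv> (\<lambda>j. A j + Delta_coeff k m w \<mu> \<Delta> j)"
  assumes coeffs: "\<And>j. j \<le> m \<Longrightarrow> A j \<in> carrier_mat n n"
    and lead: "invertible_mat (A m)"
    and weights: "\<And>j. j \<le> m \<Longrightarrow> w j \<ge> 0" "w 0 > 0"
    and k: "1 \<le> k" "k \<le> n"
    and distinct: "inj_on \<mu> {1..k}"
    and beta: "\<And>p. p \<in> {1..k} \<Longrightarrow> beta k m w \<mu> p \<noteq> 0"
    and gamma: "\<gamma> > 0"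
    and sing: "singular_vectors F s u v"
    and rank: "vec_space.rank n (block_cols n k v) = k"
  shows "\<forall>p\<in>{1..k}. matpoly_eigenvalue n m Q (\<mu> p) \<and>
           matpoly_eigenvector n m Q (hat_vec n \<mu> \<gamma> v p) (\<mu> p)"
proof
  fix p assume p: "p \<in> {1..k}"
  let ?P = "matpoly_eval n m A" and ?v = "hat_vec n \<mu> \<gamma> v p" and ?u = "hat_vec n \<mu> \<gamma> u p"
  have P: "?P z \<in> carrier_mat n n" for z unfolding matpoly_eval_def by simp
  have u: "u \<in> carrier_vec (n * k)" and v: "v \<in> carrier_vec (n * k)"
    and Fv: "F *\<^sub>v v = of_real s \<cdot>\<^sub>v u"
    using sing unfolding singular_vectors_def F_def by (auto simp: F_mat_def)
  have inj: "y = 0\<^sub>v k" if "y \<in> carrier_vec k" "hat_mat n k \<mu> \<gamma> v *\<^sub>v y = 0\<^sub>v n" for y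
    using hat_mat_injective[OF vec_space.full_rank_injective[OF block_cols_carrier rank]] that by blast
  have D: "Delta_mat n k m w \<mu> \<gamma> s u v \<in> carrier_mat n n"
    using Delta_mat_carrier pseudoinverse_mult_self(1)[OF hat_mat_carrier] inj by blast
  \<comment> \<open>The vector \<open>?v\<close> is the image of a unit vector under an injective
    matrix.\<close>
  have v0: "?v \<noteq> 0\<^sub>v n"
  proof
    assume 0: "?v = 0\<^sub>v n"
    have "hat_mat n k \<mu> \<gamma> v *\<^sub>v unit_vec k (p - 1) = ?v"
    proof -
      have "p - 1 < k" using p by auto
      then show ?thesis
        unfolding col_hat_mat[OF p, symmetric]
        by (intro eq_vecI) (auto simp del: One_nat_def)
    qed
    then have "unit_vec k (p - 1) = (0\<^sub>v k :: complex vec)" using inj 0 by simp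
    then have "(1 :: complex) = 0" using p index_unit_vec(1)[of "p - 1" k "p - 1"] by auto
    then show False by simp
  qed
  \<comment> \<open>This is the \<open>p\<close>-th hatted block of the singular vector equation
    \<open>F *\<^sub>v v = of_real s \<cdot>\<^sub>v u\<close>.\<close>
  have Pv: "?P (\<mu> p) *\<^sub>v ?v = of_real s \<cdot>\<^sub>v ?u"
    using eval_mult_hat_vec[where P = ?P and \<gamma> = \<gamma>, OF P distinct v p] Fv hat_vec_smult[OF u p] unfolding F_def by simp
  have "matpoly_eval n m Q (\<mu> p) *\<^sub>v ?v = (?P (\<mu> p) + beta k m w \<mu> p \<cdot>\<^sub>m \<Delta>) *\<^sub>v ?v"
    unfolding Q_def \<Delta>_def by (subst matpoly_eval_perturbed[OF coeffs D]) auto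
  also have "\<dots> = of_real s \<cdot>\<^sub>v ?u + beta k m w \<mu> p \<cdot>\<^sub>v (\<Delta> *\<^sub>v ?v)"
    unfolding Pv[symmetric] \<Delta>_def
    by (subst add_mult_distrib_mat_vec[OF P _ hat_vec_carrier])
      (use D in \<open>auto simp: smult_mult_mat_vec[OF D hat_vec_carrier]\<close>)
  also have "\<Delta> *\<^sub>v ?v = (- of_real s / beta k m w \<mu> p) \<cdot>\<^sub>v ?u"
    unfolding \<Delta>_def by (rule Delta_mat_mult_hat_vec[OF inj p])
  \<comment> \<open>Since \<open>beta k m w \<mu> p\<close> is nonzero, it cancels against the
    division built into \<open>\<Delta>\<close>, leaving \<open>s\<close> and \<open>- s\<close> as
    coefficients of \<open>?u\<close>.\<close>
  also have "of_real s \<cdot>\<^sub>v ?u + beta k m w \<mu> p \<cdot>\<^sub>v ((- of_real s / beta k m w \<mu> p) \<cdot>\<^sub>v ?u) = 0\<^sub>v n"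
    using beta[OF p] by (intro eq_vecI) (auto simp: hat_vec_def)
  finally have "matpoly_eigenvector n m Q ?v (\<mu> p)"
    unfolding matpoly_eigenvector_def using v0 by simp
  then show "matpoly_eigenvalue n m Q (\<mu> p) \<and> matpoly_eigenvector n m Q ?v (\<mu> p)"
    unfolding matpoly_eigenvalue_def by blast
qed

end
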